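(* Let $\mathcal{M} = (V,F)$ be a data mesh in $\mathbb{R}^3$, where $F$ is a finite non-empty set of simplices (points, edges, triangles), and let $g$ be a query primitive (a point, edge or triangle in $\mathbb{R}^3$). Suppose each $f_i \in F$ has an associated weight function $w_i$ with $1 \le w_i(g) \le A$ for some constant $A$ (independent of $i$). Let $d_{min} = \min_{f_i \in F} d(f_i, g)$, and for $\alpha > 0$ define $$\hat{d}(\mathcal{M}, g) = -\frac{1}{\alpha} \log \left( \sum_{f_i \in F} w_i(g) \exp\left(-\alpha\, d(f_i, g)\right) \right).$$ Then for all $\alpha > 0$, $$d_{min} \ \ge\ \hat{d}(\mathcal{M}, g)\ \ge\ d_{min} - \frac{\log (A|F|)}{\alpha}.$$
   Context: A data mesh $\mathcal{M} = (V,F)$ consists of a finite set $V$ of vertices in $\mathbb{R}^3$ and a finite set $F$ of primitives $f_i$, each of which is a simplex (a point, an edge, or a triangle) given by a tuple of indices into $V$ and identified with the convex hull of the corresponding vertices; $|F|$ is the number of primitives. A query primitive $g$ is likewise a point, an edge (line segment), or a triangle in $\mathbb{R}^3$. For two such simplices $f$ and $g$, $d(f,g) = \min_{x \in f,\, y \in g} \lVert x - y \rVert$ is the minimum Euclidean distance between them. Each weight function $w_i$ assigns a real number $w_i(g)$ to the query primitive $g$; only the bounds $1 \le w_i(g) \le A$ are assumed. $\log$ is the natural logarithm. *)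

theory Defs
  imports "HOL-Analysis.Analysis"
begin

definition primitive :: "(real^3) set \<Rightarrow> bool" where
  "primitive S \<longleftrightarrow> 0 simplex S \<or> 1 simplex S \<or> 2 simplex S"

text \<open>The finite vertex set is given by an enumeration without repetitions, so that the
  positions in the list serve as the vertex indices.  A primitive of the mesh is a tuple of
  indices (\<^term>\<open>prims\<close>); the tuple itself is the label \<open>i\<close> of
  \<open>f\<^sub>i\<close>, and \<open>hull_of\<close> is the point set it is identified with.\<close>

record mesh =
  verts :: "(real^3) list"
  prims :: "nat list set"

definition hull_of :: "mesh \<Rightarrow> nat list \<Rightarrow> (real^3) set" where
  "hull_of M t = convex hull ((\<lambda>k. verts M ! k) ` set t)"

text \<open>Requiring the hull of an \<open>n\<close>-tuple to be an \<open>(n - 1)\<close>-simplex forces its indices to be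
  distinct and its vertices to be affinely independent.\<close>

definition data_mesh :: "mesh \<Rightarrow> bool" where
  "data_mesh M \<longleftrightarrow>
     distinct (verts M) \<and> finite (prims M) \<and>
     (\<forall>t\<in>prims M. length t \<in> {1, 2, 3} \<and> set t \<subseteq> {..<length (verts M)} \<and>
        (int (length t) - 1) simplex hull_of M t)"

text \<open>The library's \<^const>\<open>setdist\<close> is an infimum; on primitives it is attained, so it is
  the minimum distance.\<close>

lemma primitive_compact: "primitive S \<Longrightarrow> compact S"
  unfolding primitive_def simplex_def
  by (auto intro!: finite_imp_compact_convex_hull aff_independent_finite)

lemma primitive_nonempty: "primitive S \<Longrightarrow> S \<noteq> {}"
  unfolding primitive_def by auto

lemma setdist_primitive_attained:
  assumes "primitive S" "primitive T"
  shows "\<exists>x\<in>S. \<exists>y\<in>T. setdist S T = dist x y \<and> (\<forall>x'\<in>S. \<forall>y'\<in>T. dist x y \<le> dist x' y')"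
  using setdist_compact_closed[OF primitive_compact[OF assms(1)]
      compact_imp_closed[OF primitive_compact[OF assms(2)]]
      primitive_nonempty[OF assms(1)] primitive_nonempty[OF assms(2)]]
  by (metis setdist_le_dist)

lemma data_mesh_primitive:
  assumes "data_mesh M" "t \<in> prims M"
  shows "primitive (hull_of M t)"
  using assms unfolding data_mesh_def primitive_def by fastforce

definition d_min :: "mesh \<Rightarrow> (real^3) set \<Rightarrow> real" where
  "d_min M g = Min ((\<lambda>t. setdist (hull_of M t) g) ` prims M)"

definition smooth_dist ::
  "real \<Rightarrow> (nat list \<Rightarrow> (real^3) set \<Rightarrow> real) \<Rightarrow> mesh \<Rightarrow> (real^3) set \<Rightarrow> real" where
  "smooth_dist \<alpha> w M g =
     - (1 / \<alpha>) * ln (\<Sum>t\<in>prims M. w t g * exp (- \<alpha> * setdist (hull_of M t) g))"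

end

theory Submission
  imports Defs
begin

text \<open>The weighted sum of exponentials is controlled by the nearest primitive. Its term alone
  is at least exp(-\<alpha> d_min), because its weight is at least 1, and the other terms are
  nonnegative; conversely, each of the |F| terms is at most A exp(-\<alpha> d_min). Taking
  logarithms and dividing by -\<alpha>, which reverses the order, turns this sandwich into the two
  claimed bounds. The sandwich is a fact about finitely many reals, so
  \<open>weighted_exp_sum_bounds\<close> proves it for an arbitrary finite family.\<close>

lemma weighted_exp_sum_bounds:
  fixes d u :: "'a \<Rightarrow> real"
  assumes fin: "finite I" and ne: "I \<noteq> {}"
    and u: "\<And>i. i \<in> I \<Longrightarrow> 1 \<le> u i \<and> u i \<le> A"
    and "\<alpha> \<ge> 0"
  defines "S \<equiv> \<Sum>i\<in>I. u i * exp (- \<alpha> * d i)"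
    and "m \<equiv> Min (d ` I)"
  shows "exp (- \<alpha> * m) \<le> S" and "S \<le> A * real (card I) * exp (- \<alpha> * m)"
proof -
  have "m \<in> d ` I"
    unfolding m_def using fin ne by (intro Min_in) auto
  then obtain k where k: "k \<in> I" "m = d k"
    by blast
  have nonneg: "0 \<le> u i" if "i \<in> I" for i
    using u[OF that] by linarith
  \<comment> \<open>Keep only the term of the minimiser \<open>k\<close>.\<close>
  have "exp (- \<alpha> * m) \<le> u k * exp (- \<alpha> * d k)"
    using u[OF k(1)] k(2) by simp
  also have "\<dots> \<le> S"
    unfolding S_def using fin k(1) nonneg by (intro member_le_sum) auto
  finally show "exp (- \<alpha> * m) \<le> S" .
  have "u i * exp (- \<alpha> * d i) \<le> A * exp (- \<alpha> * m)" if "i \<in> I" for i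
  proof (rule mult_mono)
    have "m \<le> d i"
      unfolding m_def using fin that by simp
    then show "exp (- \<alpha> * d i) \<le> exp (- \<alpha> * m)"
      using \<open>\<alpha> \<ge> 0\<close> by (simp add: mult_left_mono)
    \<comment> \<open>The sign of \<open>A\<close> is a side condition of \<open>mult_mono\<close>;
      it follows from 1 \<le> \<open>u i\<close> \<le> \<open>A\<close>.\<close>
    show "u i \<le> A" "0 \<le> A"
      using u[OF that] by auto
  qed simp
  then have "S \<le> real (card I) * (A * exp (- \<alpha> * m))"
    unfolding S_def by (rule sum_bounded_above)
  then show "S \<le> A * real (card I) * exp (- \<alpha> * m)"
    by (simp add: mult_ac)
qed

theorem theoremA1:
  fixes M :: mesh
    and g :: "(real^3) set"
    and w :: "nat list \<Rightarrow> (real^3) set \<Rightarrow> real"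
    and A \<alpha> :: real
  assumes "data_mesh M"
    and "prims M \<noteq> {}"
    and "primitive g"
    and "\<And>t. t \<in> prims M \<Longrightarrow> 1 \<le> w t g \<and> w t g \<le> A"
    and "\<alpha> > 0"
  shows "d_min M g \<ge> smooth_dist \<alpha> w M g \<and>
         smooth_dist \<alpha> w M g \<ge> d_min M g - ln (A * real (card (prims M))) / \<alpha>"
proof -
  define S where "S = (\<Sum>t\<in>prims M. w t g * exp (- \<alpha> * setdist (hull_of M t) g))"
  define C where "C = A * real (card (prims M))"
  have fin: "finite (prims M)"
    using assms(1) by (simp add: data_mesh_def)
  have lower: "exp (- \<alpha> * d_min M g) \<le> S"
    and upper: "S \<le> C * exp (- \<alpha> * d_min M g)"
    using weighted_exp_sum_bounds[where u = "\<lambda>t. w t g" and d = "\<lambda>t. setdist (hull_of M t) g",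
        OF fin assms(2) assms(4) less_imp_le[OF assms(5)]]
    unfolding S_def C_def d_min_def by auto
  have "S > 0"
    using lower by (meson exp_gt_zero less_le_trans)
  \<comment> \<open>Positivity of \<open>C\<close> is read off from the sandwich itself; it lets the
    logarithm of the upper bound split into a sum.\<close>
  then have "C * exp (- \<alpha> * d_min M g) > 0"
    using upper by linarith
  then have "C > 0"
    by (simp add: zero_less_mult_iff)
  \<comment> \<open>The lower bound on \<open>S\<close> yields the upper bound on
    \<open>smooth_dist\<close>.\<close>
  have "- \<alpha> * d_min M g \<le> ln S"
    using lower \<open>S > 0\<close> by (simp add: ln_ge_iff)
  then have "- d_min M g \<le> ln S / \<alpha>"
    using \<open>\<alpha> > 0\<close> by (simp add: pos_le_divide_eq mult_ac)
  \<comment> \<open>The upper bound on \<open>S\<close> yields the lower bound on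
    \<open>smooth_dist\<close>; the factor \<open>C\<close> becomes the error
    \<open>ln C / \<alpha>\<close>.\<close>
  moreover have "ln S \<le> ln C - \<alpha> * d_min M g"
    using \<open>C > 0\<close> ln_mono[OF upper \<open>S > 0\<close>] by (simp add: ln_mult)
  then have "ln S / \<alpha> \<le> ln C / \<alpha> - d_min M g"
    using \<open>\<alpha> > 0\<close> by (simp add: field_simps)
  moreover have "smooth_dist \<alpha> w M g = - (ln S / \<alpha>)"
    by (simp add: smooth_dist_def S_def)
  ultimately show ?thesis
    unfolding C_def by linarith
qed

end
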